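(* Let $w:\mathbb{Z}^+\to\mathbb{R}$ be a non-negative increasing function. Let $u:\mathbb{Z}^+\to\mathbb{C}$ be a function vanishing at infinity, with decreasing rearrangement $\widetilde u$. Then $$\sum_{n\in\mathbb{Z}^+}|u(n)-u(n+1)|^p\,w(n)\;\ge\;\sum_{n\in\mathbb{Z}^+}|\widetilde u(n)-\widetilde u(n+1)|^p\,w(n)$$ for all $p\ge 1$. Moreover, if $w(n)>0$ and if $u$ produces equality in this inequality, then $|u|=\widetilde u$. In particular, $|u|$ is a decreasing function.
   Context: $\mathbb{Z}^+=\{0,1,2,\dots\}$ is the set of non-negative integers. A function $u:\mathbb{Z}^+\to\mathbb{C}$ vanishes at infinity if $\{n:|u(n)|>t\}$ is finite for every $t>0$. For a finite set $A\subset\mathbb{Z}^+$ with $|A|=k$, its symmetric rearrangement $A^*$ is the set of all non-negative integers less than or equal to $k-1$. The decreasing rearrangement of $u$ is $\widetilde u(n):=\int_0^\infty\chi_{\{|u|>t\}^*}(n)\,dt$; thus $\widetilde u(0)$ is the largest value of $|u|$, $\widetilde u(1)$ the second largest value (counted with multiplicity), and so on.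
   Formalization: The equality case is stated only when the two sums are finite; if both are infinite the claim fails, e.g. p=1, w(n)=(n+2)^2, u=(1/2,1,1/3,1/4,...), where both sums are infinite but |u| is not decreasing. *)

theory Defs
  imports "HOL-Analysis.Analysis"
begin

definition vanishes_at_infinity :: "(nat \<Rightarrow> complex) \<Rightarrow> bool" where
  "vanishes_at_infinity u \<longleftrightarrow> (\<forall>t>0. finite {n. cmod (u n) > t})"

text \<open>
  Meaningful for finite \<open>A\<close> only; \<open>n < card A\<close> is \<open>n \<le> k - 1\<close> with \<open>k = card A\<close>,
  written without truncated subtraction so that the rearrangement of the empty set is empty.
\<close>
definition symmetric_rearrangement :: "nat set \<Rightarrow> nat set" where
  "symmetric_rearrangement A = {n. n < card A}"

text \<open>
  The layer-cake integral is a Lebesgue integral over the open half-line: at \<open>t = 0\<close> the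
  level set may be infinite, and this null point is left out. If \<open>u\<close> vanishes at infinity
  then the integrand is the indicator of a bounded interval of levels \<open>t\<close>, hence integrable.
\<close>
definition decreasing_rearrangement :: "(nat \<Rightarrow> complex) \<Rightarrow> nat \<Rightarrow> real" where
  "decreasing_rearrangement u n =
     (LINT t:{0<..}|lborel. indicator (symmetric_rearrangement {m. cmod (u m) > t}) n)"

end

(* Whenever b = decreasing_rearrangement u drops strictly between n and n + 1, the level set
   {|u| >= b n} has exactly n + 1 elements, so its largest element N n is at least n, and |u| falls
   across all of [b (n + 1), b n] between N n and N n + 1.  For a fixed m the drops of b with
   N n = m are disjoint subintervals of [|u (m + 1)|, |u m|], so superadditivity of x^p and
   monotonicity of w bound their total contribution by that of the descent of |u| at m.  Ascents of
   |u| are never used in this estimate; hence equality forces |u| to be decreasing. *)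

theory Submission
  imports Defs
begin

text \<open>Split \<open>x powr p\<close> as \<open>x * x powr (p - 1)\<close> and bound the second
  factor by the same power of the whole sum, which is legitimate as
  \<open>p - 1 \<ge> 0\<close>.\<close>

lemma sum_powr_le_powr_sum:
  fixes f :: "'a \<Rightarrow> real"
  assumes "finite A" "\<And>x. x \<in> A \<Longrightarrow> 0 \<le> f x" "1 \<le> p"
  shows "(\<Sum>x\<in>A. f x powr p) \<le> (\<Sum>x\<in>A. f x) powr p"
proof -
  have split: "y powr p = y * y powr (p - 1)" if "0 \<le> y" for y :: real
    using that powr_mult_base[of y "p - 1"] by simp
  have "(\<Sum>x\<in>A. f x powr p) = (\<Sum>x\<in>A. f x * f x powr (p - 1))"
    using assms split by (intro sum.cong) auto
  also have "\<dots> \<le> (\<Sum>x\<in>A. f x * sum f A powr (p - 1))"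
    using assms by (intro sum_mono mult_left_mono powr_mono2 member_le_sum) auto
  also have "\<dots> = sum f A powr p"
    using assms split[of "sum f A"] by (simp add: sum_distrib_right sum_nonneg)
  finally show ?thesis .
qed

text \<open>Filling the gaps of \<open>A\<close> up to an interval adds only nonnegative terms, and
  over an interval the sum telescopes.\<close>

lemma sum_diff_Suc_antimono_le:
  fixes b :: "nat \<Rightarrow> real"
  assumes "antimono b" "finite A" "A \<noteq> {}" "\<And>n. n \<in> A \<Longrightarrow> b n \<le> x" "\<And>n. n \<in> A \<Longrightarrow> y \<le> b (Suc n)"
  shows "(\<Sum>n\<in>A. b n - b (Suc n)) \<le> x - y"
proof -
  have le: "Min A \<le> Max A" using assms by simp
  have "(\<Sum>n\<in>A. b n - b (Suc n)) \<le> (\<Sum>n=Min A..Max A. b n - b (Suc n))"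
    using assms by (intro sum_mono2) (auto simp: antimono_iff_le_Suc)
  also have "\<dots> = b (Min A) - b (Suc (Max A))"
    using sum_Suc_diff[of "Min A" "Max A" "\<lambda>n. - b n"] le by simp
  also have "\<dots> \<le> x - y"
    using assms(4)[of "Min A"] assms(5)[of "Max A"] assms(2,3) by simp
  finally show ?thesis .
qed

text \<open>The gap \<open>g m - f m\<close>, added to \<open>f\<close> at the single index
  \<open>m\<close>, leaves it below \<open>g\<close>. Finiteness of \<open>suminf f\<close> is
  essential: an infinite sum would absorb the gap.\<close>

lemma suminf_ennreal_strict_mono:
  fixes f g :: "nat \<Rightarrow> ennreal"
  assumes "\<And>n. f n \<le> g n" "f m < g m" "suminf f < \<infinity>"
  shows "suminf f < suminf g"
proof -
  define d where "d n = (if n = m then g m - f m else 0)" for n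
  have "suminf f < suminf f + (g m - f m)"
    using assms ennreal_add_left_cancel_less[of "suminf f" 0] by (simp add: diff_gt_0_iff_gt_ennreal)
  also have "g m - f m = suminf d"
    unfolding d_def by (subst suminf_finite[of "{m}"]) auto
  also have "suminf f + suminf d = (\<Sum>n. f n + d n)"
    by (intro suminf_add) auto
  also have "\<dots> \<le> suminf g"
    using assms by (intro suminf_le) (auto simp: d_def add_diff_inverse_ennreal less_imp_le)
  finally show ?thesis .
qed

text \<open>Captures the decreasing rearrangement through its level sets, so that the comparison of
  \<open>a\<close> and \<open>b\<close> needs no integral. Levels are positive because at
  \<open>t = 0\<close> the level set may be infinite, where \<open>card\<close> is 0.\<close>

locale rearrangement =
  fixes a b :: "nat \<Rightarrow> real"
  assumes nonneg: "0 \<le> a n" "0 \<le> b n"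
    and finite_level: "0 < t \<Longrightarrow> finite {k. t < a k}"
    and less_iff: "0 < t \<Longrightarrow> t < b n \<longleftrightarrow> n < card {k. t < a k}"
begin

lemma antimono_b: "antimono b"
proof (rule antimonoI, rule ccontr)
  fix m n :: nat
  assume "m \<le> n" "\<not> b n \<le> b m"
  then obtain t where "b m < t" "t < b n"
    using dense[of "b m" "b n"] by auto
  moreover have "0 < t" using \<open>b m < t\<close> nonneg(2)[of m] by simp
  ultimately show False
    using less_iff[of t m] less_iff[of t n] \<open>m \<le> n\<close> by simp
qed

text \<open>This is the map \<open>N\<close> of the opening comment, used only where
  \<open>b\<close> drops strictly. For \<open>b n = 0\<close> the set is all of \<open>nat\<close>
  and \<open>Max\<close> is unspecified.\<close>

definition last_index :: "nat \<Rightarrow> nat" where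
  "last_index n = Max {k. b n \<le> a k}"

lemma last_index:
  assumes "b (Suc n) < b n"
  shows "n \<le> last_index n" "b n \<le> a (last_index n)" "a (Suc (last_index n)) \<le> b (Suc n)"
proof -
  let ?A = "{k. b n \<le> a k}"
  have level: "{k. t < a k} = ?A" "card ?A = Suc n" "finite ?A" if t: "b (Suc n) < t" "t < b n" for t
  proof -
    have "0 < t" using t nonneg(2)[of "Suc n"] by simp
    have card: "card {k. t < a k} = Suc n"
      using less_iff[OF \<open>0 < t\<close>, of n] less_iff[OF \<open>0 < t\<close>, of "Suc n"] t by simp
    \<comment> \<open>No value of \<open>a\<close> lies strictly between \<open>t\<close> and
      \<open>b n\<close>: such an \<open>a x\<close> would itself be a level with at least
      \<open>n + 1\<close> indices above it, and together with \<open>x\<close> the level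
      \<open>t\<close> would have at least \<open>n + 2\<close>.\<close>
    have "b n \<le> a x" if "t < a x" for x
    proof (rule ccontr)
      assume "\<not> b n \<le> a x"
      then have "n < card {k. a x < a k}"
        using less_iff[of "a x" n] \<open>0 < t\<close> that by simp
      moreover have "card {k. a x < a k} < card {k. t < a k}"
        using that by (intro psubset_card_mono finite_level[OF \<open>0 < t\<close>]) auto
      ultimately show False using card by simp
    qed
    then show "{k. t < a k} = ?A" using t by force
    then show "card ?A = Suc n" "finite ?A" using card finite_level[OF \<open>0 < t\<close>] by simp_all
  qed
  obtain t where t: "b (Suc n) < t" "t < b n" using dense[OF assms] by auto
  note fin = level(3)[OF t] and card = level(2)[OF t]
  have "?A \<noteq> {}" using card by force
  then show "b n \<le> a (last_index n)" using Max_in[OF fin] by (simp add: last_index_def)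
  \<comment> \<open>The largest of \<open>n + 1\<close> distinct natural numbers is at least
    \<open>n\<close>.\<close>
  have "?A \<subseteq> {..last_index n}" using fin by (auto simp: last_index_def)
  then have "card ?A \<le> Suc (last_index n)" using card_mono[of "{..last_index n}"] by fastforce
  then show "n \<le> last_index n" using card by simp
  have "Suc (last_index n) \<notin> ?A"
    using Max_ge[OF fin] by (fastforce simp: last_index_def)
  \<comment> \<open>All levels inside the drop share the level set \<open>?A\<close>, so
    \<open>t\<close> may tend to \<open>b (Suc n)\<close>. This gives more than
    \<open>a (Suc (last_index n)) < b n\<close>.\<close>
  then have "\<not> t < a (Suc (last_index n))" if "b (Suc n) < t" "t < b n" for t
    using level(1)[OF that] by blast
  then show "a (Suc (last_index n)) \<le> b (Suc n)"
    using assms by (intro dense_ge_bounded[of "b (Suc n)" "b n"]) (auto simp: not_less)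
qed

text \<open>All drops in \<open>A\<close> are charged to the single index \<open>m\<close>. The
  truncation by \<open>max 0\<close> keeps only descents of \<open>a\<close>; the equality case
  rests on this sharper bound.\<close>

lemma fiber_sum_le:
  fixes w :: "nat \<Rightarrow> real"
  assumes w: "\<And>n. 0 \<le> w n" "mono w" and p: "1 \<le> p"
    and A: "finite A" "\<And>n. n \<in> A \<Longrightarrow> b (Suc n) < b n \<and> last_index n = m"
  shows "(\<Sum>n\<in>A. (b n - b (Suc n)) powr p * w n) \<le> max 0 (a m - a (Suc m)) powr p * w m"
proof (cases "A = {}")
  case True
  then show ?thesis using w by simp
next
  case False
  have idx: "n \<le> m" "b n \<le> a m" "a (Suc m) \<le> b (Suc n)" "b (Suc n) < b n" if "n \<in> A" for n
    using last_index[of n] A(2)[OF that] by auto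
  have total: "(\<Sum>n\<in>A. b n - b (Suc n)) \<le> a m - a (Suc m)"
    using idx by (intro sum_diff_Suc_antimono_le antimono_b A(1) False)
  have nn: "0 \<le> (\<Sum>n\<in>A. b n - b (Suc n))"
    using idx(4) by (intro sum_nonneg) (simp add: less_imp_le)
  \<comment> \<open>Monotonicity of \<open>w\<close> enters here: charging a drop to
    \<open>m\<close> never moves it to the left.\<close>
  have "(\<Sum>n\<in>A. (b n - b (Suc n)) powr p * w n) \<le> (\<Sum>n\<in>A. (b n - b (Suc n)) powr p * w m)"
    using idx(1) w by (intro sum_mono mult_left_mono) (auto dest: monoD)
  also have "\<dots> = (\<Sum>n\<in>A. (b n - b (Suc n)) powr p) * w m"
    by (simp add: sum_distrib_right)
  also have "\<dots> \<le> (\<Sum>n\<in>A. b n - b (Suc n)) powr p * w m"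
    using A(1) idx(4) p w by (intro mult_right_mono sum_powr_le_powr_sum) (auto simp: less_imp_le)
  also have "\<dots> \<le> max 0 (a m - a (Suc m)) powr p * w m"
    using total nn p w by (intro mult_right_mono powr_mono2) auto
  finally show ?thesis .
qed

text \<open>A partial sum is finite and can be grouped by the value of \<open>last_index\<close>.
  Different groups are charged to different indices, so their bounds add up to a part of the series
  on the right.\<close>

lemma suminf_le_suminf_descents:
  fixes w :: "nat \<Rightarrow> real"
  assumes w: "\<And>n. 0 \<le> w n" "mono w" and p: "1 \<le> p"
  shows "(\<Sum>n. ennreal (\<bar>b n - b (Suc n)\<bar> powr p * w n))
    \<le> (\<Sum>n. ennreal (max 0 (a n - a (Suc n)) powr p * w n))"
proof (rule suminf_le_const)
  fix K
  define A where "A = {n. n < K \<and> b (Suc n) < b n}"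
  have fin: "finite A" by (simp add: A_def)
  have "(\<Sum>n<K. ennreal (\<bar>b n - b (Suc n)\<bar> powr p * w n))
      = ennreal (\<Sum>n<K. \<bar>b n - b (Suc n)\<bar> powr p * w n)"
    using w by (intro sum_ennreal) simp
  \<comment> \<open>Indices without a strict drop contribute \<open>0 powr p = 0\<close>.\<close>
  also have "(\<Sum>n<K. \<bar>b n - b (Suc n)\<bar> powr p * w n) = (\<Sum>n\<in>A. \<bar>b n - b (Suc n)\<bar> powr p * w n)"
    using antimono_b by (intro sum.mono_neutral_right) (auto simp: A_def antimono_iff_le_Suc order_less_le)
  also have "\<dots> = (\<Sum>n\<in>A. (b n - b (Suc n)) powr p * w n)"
    by (intro sum.cong) (auto simp: A_def)
  also have "\<dots> = (\<Sum>m\<in>last_index ` A. \<Sum>n\<in>{n \<in> A. last_index n = m}. (b n - b (Suc n)) powr p * w n)"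
    using fin by (rule sum.image_gen)
  also have "\<dots> \<le> (\<Sum>m\<in>last_index ` A. max 0 (a m - a (Suc m)) powr p * w m)"
    using fin w p by (intro sum_mono fiber_sum_le) (auto simp: A_def)
  also have "ennreal \<dots> = (\<Sum>m\<in>last_index ` A. ennreal (max 0 (a m - a (Suc m)) powr p * w m))"
    using w by (intro sum_ennreal[symmetric]) simp
  also have "\<dots> \<le> (\<Sum>m. ennreal (max 0 (a m - a (Suc m)) powr p * w m))"
    using fin by (intro sum_le_suminf) auto
  \<comment> \<open>The real inequality was substituted under \<open>ennreal\<close>, so the chain
    still owes the monotonicity of \<open>ennreal\<close>.\<close>
  finally show "(\<Sum>n<K. ennreal (\<bar>b n - b (Suc n)\<bar> powr p * w n))
    \<le> (\<Sum>m. ennreal (max 0 (a m - a (Suc m)) powr p * w m))"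
    by this (rule ennreal_leI)
qed simp

text \<open>The level sets of a decreasing sequence are initial segments, so \<open>n\<close> lies
  in one exactly when its cardinality exceeds \<open>n\<close>. Nonnegative numbers exceeding the
  same positive levels are equal.\<close>

lemma eq_if_antimono:
  assumes "antimono a"
  shows "a = b"
proof
  fix n
  have iff: "t < b n \<longleftrightarrow> t < a n" if "0 < t" for t
  proof
    assume "t < b n"
    then have "n < card {k. t < a k}" using less_iff[OF that] by simp
    moreover have "{k. t < a k} \<subseteq> {..<n}" if "\<not> t < a n"
    proof
      fix k assume "k \<in> {k. t < a k}"
      then show "k \<in> {..<n}" using that antimonoD[OF assms, of n k] by (cases "k < n") auto
    qed
    ultimately show "t < a n" using card_mono[of "{..<n}" "{k. t < a k}"] by fastforce
  next
    assume "t < a n"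
    then have "{..n} \<subseteq> {k. t < a k}" using antimonoD[OF assms] by force
    then have "card {..n} \<le> card {k. t < a k}" by (intro card_mono finite_level that)
    then show "t < b n" using less_iff[OF that] by simp
  qed
  show "a n = b n"
  proof (rule antisym; rule ccontr)
    assume "\<not> a n \<le> b n"
    then obtain t where "b n < t" "t < a n" using dense[of "b n" "a n"] by auto
    then show False using iff[of t] nonneg(2)[of n] by simp
  next
    assume "\<not> b n \<le> a n"
    then obtain t where "a n < t" "t < b n" using dense[of "a n" "b n"] by auto
    then show False using iff[of t] nonneg(1)[of n] by simp
  qed
qed

end

text \<open>The levels counted by the layer-cake integral at \<open>n\<close> form an open interval
  starting at 0, and the integral is its length \<open>\<beta> n\<close>.\<close>

lemma rearrangement_decreasing_rearrangement:
  assumes "vanishes_at_infinity u"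
  shows "rearrangement (\<lambda>n. cmod (u n)) (decreasing_rearrangement u)"
proof -
  have fin: "finite {k. t < cmod (u k)}" if "0 < t" for t
    using assms that by (auto simp: vanishes_at_infinity_def)
  define S where "S n = {t. 0 < t \<and> n < card {k. t < cmod (u k)}}" for n
  \<comment> \<open>Inserting 0 gives \<open>\<beta> n = 0\<close> when \<open>S n\<close> is
    empty.\<close>
  define \<beta> where "\<beta> n = Sup (insert 0 (S n))" for n
  have "bdd_above (range (\<lambda>k. cmod (u k)))"
  proof -
    \<comment> \<open>The threshold 1 is arbitrary: only finitely many values lie above it.\<close>
    have "range (\<lambda>k. cmod (u k)) \<subseteq> (\<lambda>k. cmod (u k)) ` {k. 1 < cmod (u k)} \<union> {..1}"
      by (auto simp: not_less)
    moreover have "bdd_above ((\<lambda>k. cmod (u k)) ` {k. 1 < cmod (u k)} \<union> {..1})"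
      using fin[of 1] by (simp add: bdd_above_finite)
    ultimately show ?thesis by (rule bdd_above_mono[rotated])
  qed
  then obtain M where M: "cmod (u k) \<le> M" for k by (auto simp: bdd_above_def)
  have "t \<le> M" if "t \<in> S n" for t n
  proof (rule ccontr)
    assume "\<not> t \<le> M"
    then have "\<not> t < cmod (u k)" for k using M[of k] by simp
    with that show False by (simp add: S_def)
  qed
  then have bdd: "bdd_above (insert 0 (S n))" for n
    unfolding bdd_above_insert by (auto simp: bdd_above_def)
  have \<beta>_nonneg: "0 \<le> \<beta> n" for n
    unfolding \<beta>_def by (rule cSup_upper[OF _ bdd]) simp
  have \<beta>_iff: "t < \<beta> n \<longleftrightarrow> t \<in> S n" if "0 < t" for t n
  proof
    assume "t < \<beta> n"
    then obtain s where s: "s \<in> insert 0 (S n)" "t < s"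
      unfolding \<beta>_def using less_cSup_iff[OF _ bdd] by blast
    then have "s \<in> S n" using that by auto
    have "card {k. s < cmod (u k)} \<le> card {k. t < cmod (u k)}"
      using s(2) by (intro card_mono fin[OF that]) auto
    then show "t \<in> S n" using \<open>s \<in> S n\<close> that by (simp add: S_def)
  next
    assume t: "t \<in> S n"
    \<comment> \<open>The supremum is not attained by a positive level: \<open>t\<close> can be
      raised to any \<open>s\<close> below the least value above \<open>t\<close> without changing
      the level set.\<close>
    let ?A = "(\<lambda>k. cmod (u k)) ` {k. t < cmod (u k)}"
    have "{k. t < cmod (u k)} \<noteq> {}"
    proof
      assume "{k. t < cmod (u k)} = {}"
      with t show False by (simp add: S_def)
    qed
    then have "t < Min ?A" using fin[OF that] by (subst Min_gr_iff) auto
    then obtain s where s: "t < s" "s < Min ?A" using dense by blast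
    have "{k. s < cmod (u k)} = {k. t < cmod (u k)}"
      using s fin[OF that] by (auto intro: less_le_trans[OF _ Min_le])
    then have "s \<in> S n" using t s that by (simp add: S_def)
    then have "s \<le> \<beta> n" unfolding \<beta>_def by (intro cSup_upper[OF _ bdd]) simp
    then show "t < \<beta> n" using s by simp
  qed
  have "S n = {0<..<\<beta> n}" for n
    using \<beta>_iff by (auto simp: S_def)
  have "decreasing_rearrangement u n = \<beta> n" for n
  proof -
    have "decreasing_rearrangement u n = (\<integral>t. indicator (S n) t \<partial>lborel)"
      unfolding decreasing_rearrangement_def set_lebesgue_integral_def symmetric_rearrangement_def
      by (intro Bochner_Integration.integral_cong) (auto simp: S_def indicator_def)
    also have "\<dots> = \<beta> n"
      using \<beta>_nonneg[of n] by (simp add: \<open>S n = {0<..<\<beta> n}\<close>)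
    finally show ?thesis .
  qed
  then show ?thesis
    using fin \<beta>_nonneg \<beta>_iff by unfold_locales (auto simp: S_def)
qed

text \<open>In \<open>ennreal\<close> a divergent series has the value \<open>\<infinity>\<close>.
  The equality case asks for finite sums, since \<open>\<infinity> = \<infinity>\<close> carries no
  information about the shape of \<open>u\<close>.\<close>

theorem theorem4p4:
  fixes w :: "nat \<Rightarrow> real" and u :: "nat \<Rightarrow> complex" and p :: real
  assumes "\<And>n. 0 \<le> w n" and "mono w"
    and "vanishes_at_infinity u"
    and "1 \<le> p"
  shows
    "(\<Sum>n. ennreal (cmod (u n - u (n + 1)) powr p * w n))
       \<ge> (\<Sum>n. ennreal (\<bar>decreasing_rearrangement u n - decreasing_rearrangement u (n + 1)\<bar> powr p * w n))
     \<and> ((\<forall>n. 0 < w n)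
        \<and> (\<Sum>n. ennreal (cmod (u n - u (n + 1)) powr p * w n))
           = (\<Sum>n. ennreal (\<bar>decreasing_rearrangement u n - decreasing_rearrangement u (n + 1)\<bar> powr p * w n))
        \<and> (\<Sum>n. ennreal (cmod (u n - u (n + 1)) powr p * w n)) < \<infinity>
       \<longrightarrow> (\<lambda>n. cmod (u n)) = decreasing_rearrangement u \<and> antimono (\<lambda>n. cmod (u n)))"
    (is "?B \<le> ?U \<and> (?pos \<and> _ \<and> _ \<longrightarrow> _)")
proof -
  let ?a = "\<lambda>n. cmod (u n)"
  let ?f = "\<lambda>n. ennreal (max 0 (?a n - ?a (Suc n)) powr p * w n)"
  let ?g = "\<lambda>n. ennreal (cmod (u n - u (n + 1)) powr p * w n)"
  interpret rearrangement ?a "decreasing_rearrangement u"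
    using assms(3) by (rule rearrangement_decreasing_rearrangement)
  have descents: "?B \<le> suminf ?f"
    using suminf_le_suminf_descents[OF assms(1,2,4)] by simp
  \<comment> \<open>By the reverse triangle inequality, passing to moduli and discarding ascents
    only lowers each term.\<close>
  have le: "?f n \<le> ?g n" for n
    using assms norm_triangle_ineq2[of "u n" "u (Suc n)"]
    by (intro ennreal_leI mult_right_mono powr_mono2) auto
  have "suminf ?f \<le> ?U" using le by (intro suminf_le) auto
  moreover have "antimono ?a" if pos: "\<forall>n. 0 < w n" and eq: "?U = ?B" and fin: "?U < \<infinity>"
  proof (rule ccontr)
    assume "\<not> antimono ?a"
    then obtain m where m: "?a m < ?a (Suc m)" by (auto simp: antimono_iff_le_Suc not_le)
    \<comment> \<open>At the ascent \<open>m\<close> the truncated term is 0, while the term of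
      \<open>u\<close> is positive because \<open>w m > 0\<close>.\<close>
    then have "u m \<noteq> u (m + 1)" by auto
    with m pos have "?f m < ?g m" by simp
    then have "suminf ?f < ?U"
      using le fin \<open>suminf ?f \<le> ?U\<close> by (intro suminf_ennreal_strict_mono) auto
    then show False using descents eq by simp
  qed
  ultimately show ?thesis using descents eq_if_antimono order_trans by blast
qed

end
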